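(* Let $k\in\mathbb{N}$ and let $a>0$ be real. Then $$\sum_{n=1}^\infty\frac{H_n^2}{(n+a)(n+a+k)}=\frac1k\left\{\begin{aligned}&\zeta(2)H_k^{(1)}(a-1)-H_aH_k^{(2)}(a-1)\\&-\sum_{i=1}^{k-1}\frac{H_i^{(1)}(a)}{(i+a)^2}+\sum_{j=1}^k\frac{H_{a+j-1}^2+H_{a+j-1}^{(2)}}{a+j-1}\end{aligned}\right\}.$$
   Context: $\mathbb{N}=\{1,2,3,\ldots\}$. For $n\in\mathbb{N}$, $H_n=\sum_{j=1}^n \frac1j$. Shifted harmonic numbers: for $\alpha\in\mathbb{C}\setminus\{-1,-2,\ldots\}$, $H_\alpha=\psi(\alpha+1)+\gamma=\sum_{l=1}^\infty\left(\frac1l-\frac1{l+\alpha}\right)$ ($\psi$ the digamma function, $\gamma$ the Euler–Mascheroni constant) and $H_\alpha^{(2)}=\zeta(2)-\zeta(2,\alpha+1)$, where $\zeta(s,c)=\sum_{n=0}^\infty (n+c)^{-s}$ is the Hurwitz zeta function and $\zeta$ the Riemann zeta function. Parametric harmonic numbers: $H_n^{(s)}(c)=\sum_{j=1}^n (j+c)^{-s}$ for $n\ge 0$, $c\in\mathbb{C}\setminus\{-1,-2,\ldots\}$. Empty sums are $0$. *)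

theory Defs
  imports "HOL-Analysis.Analysis"
begin

(* The series converges for Re s > 1 and c not in {0, -1, -2, ...}; powr uses the principal
   branch of the logarithm. *)
definition hurwitz_zeta :: "complex \<Rightarrow> complex \<Rightarrow> complex" where
  "hurwitz_zeta s c = (\<Sum>n. (of_nat n + c) powr (-s))"

(* Meaningful for Re s > 1. *)
definition riemann_zeta :: "complex \<Rightarrow> complex" where
  "riemann_zeta s = (\<Sum>n. of_nat (Suc n) powr (-s))"

definition shifted_harm :: "complex \<Rightarrow> complex" where
  "shifted_harm \<alpha> = Digamma (\<alpha> + 1) + euler_mascheroni"

definition shifted_harm2 :: "complex \<Rightarrow> complex" where
  "shifted_harm2 \<alpha> = riemann_zeta 2 - hurwitz_zeta 2 (\<alpha> + 1)"

definition param_harm :: "nat \<Rightarrow> complex \<Rightarrow> complex \<Rightarrow> complex" where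
  "param_harm n s c = (\<Sum>j=1..n. (of_nat j + c) powr (-s))"

lemma shifted_harm_sums:
  assumes "\<alpha> + 1 \<notin> \<int>\<^sub>\<le>\<^sub>0"
  shows "(\<lambda>l. 1 / of_nat (Suc l) - 1 / (of_nat (Suc l) + \<alpha>)) sums shifted_harm \<alpha>"
proof -
  have "\<alpha> + 1 \<noteq> 0"
    using assms by auto
  from summable_sums[OF summable_Digamma[OF this]] show ?thesis
    by (simp add: shifted_harm_def Digamma_def divide_inverse algebra_simps)
qed

end

theory Submission
  imports Defs "HOL-Real_Asymp.Real_Asymp"
begin

text \<open>
  All quantities in the theorem are real, so the argument is carried out over the reals and
  transferred to the complex numbers at the end. Writing \<open>k / ((n + a) (n + a + k))\<close> as a
  telescoping sum of the differences \<open>1 / (n + x) - 1 / (n + x + 1)\<close> over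
  \<open>x = a, \<dots>, a + k - 1\<close> reduces the claim to \<open>k = 1\<close>, that is, to evaluating
  \<open>F(x) = \<Sum>n. H\<^sub>n\<^sup>2 (1 / (n + x) - 1 / (n + x + 1))\<close> (\<open>quadratic_harmonic_sums_step\<close>). The double
  sum on the right-hand side of the theorem is what arises when each
  \<open>H\<^bsub>a + i\<^esub>\<close> in \<open>\<Sum>i. H\<^bsub>a + i\<^esub> / (a + i)\<^sup>2\<close> is expanded by the recurrence of \<open>H\<close>.

  Abel summation replaces \<open>H\<^sub>n\<^sup>2\<close> in \<open>F(x)\<close> by its increment
  \<open>(2 H\<^sub>n - 1 / n) / n\<close>. Partial fractions then leave series for the trigamma and digamma values
  and the series linear in \<open>H\<^sub>n\<close>,
  \<open>S(x) = \<Sum>n. H\<^sub>n (1 / n - 1 / (n + x)) = \<zeta>(2) + ((H\<^bsub>x - 1\<^esub>)\<^sup>2 + H\<^sup>(\<^sup>2\<^sup>)\<^bsub>x - 1\<^esub>) / 2\<close>,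
  whose closed form (\<open>linear_harmonic_sums\<close>) is the heart of the matter.

  That closed form follows from a uniqueness argument in the style of Bohr and Mollerup
  (\<open>difference_equation_mono_unique\<close>). A second Abel summation shows \<open>S(x + 1) - S(x) = H\<^sub>x / x\<close>,
  and the right-hand side satisfies the same difference equation. Both sides are increasing on
  \<open>[1, \<infinity>)\<close> and equal \<open>\<zeta>(2)\<close> at \<open>x = 1\<close>. As the increment \<open>H\<^sub>n / n\<close> tends to zero, monotonicity
  leaves no room for the two sides to differ between the integers.
\<close>

section \<open>Shifted harmonic numbers on the real line\<close>

definition real_harm :: "real \<Rightarrow> real" where
  "real_harm x = Digamma (x + 1) + euler_mascheroni"

text \<open>
  The Hurwitz zeta value \<open>\<zeta>(2, c)\<close> is the trigamma function \<open>Polygamma 1 c\<close>; in particular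
  \<open>Polygamma 1 1\<close> is \<open>\<zeta>(2)\<close>.
\<close>

definition real_harm2 :: "real \<Rightarrow> real" where
  "real_harm2 x = Polygamma 1 1 - Polygamma 1 (x + 1)"

lemma real_harm_rec: "x > 0 \<Longrightarrow> real_harm x = real_harm (x - 1) + 1 / x"
  by (simp add: real_harm_def Digamma_plus1)

lemma real_harm2_rec: "x > 0 \<Longrightarrow> real_harm2 x = real_harm2 (x - 1) + 1 / x\<^sup>2"
  by (simp add: real_harm2_def Polygamma_plus1 power2_eq_square)

lemma real_harm_0 [simp]: "real_harm 0 = 0"
  by (simp add: real_harm_def)

lemma real_harm2_0 [simp]: "real_harm2 0 = 0"
  by (simp add: real_harm2_def)

lemma real_harm_of_nat: "real_harm (real n) = harm n"
  using Digamma_of_nat[of n, where ?'a = real] by (simp add: real_harm_def add_ac)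

lemma real_harm_mono: "-1 < x \<Longrightarrow> x \<le> y \<Longrightarrow> real_harm x \<le> real_harm y"
  unfolding real_harm_def using Digamma_real_mono[of "x + 1" "y + 1"] by simp

lemma real_harm2_mono: "-1 < x \<Longrightarrow> x \<le> y \<Longrightarrow> real_harm2 x \<le> real_harm2 y"
  unfolding real_harm2_def
  using Polygamma_real_strict_antimono[of "x + 1" "y + 1" 1] by (cases "x = y") auto

lemma real_harm_sums:
  assumes "x > 0"
  shows "(\<lambda>n. 1 / (real (Suc n) * (real (Suc n) + x))) sums (real_harm x / x)"
proof -
  have "(\<lambda>n. inverse (real (Suc n)) - inverse (x + 1 + real n)) sums real_harm x"
    using summable_sums[OF summable_Digamma[of "x + 1"]] assms
    by (simp add: real_harm_def Digamma_def)
  from sums_divide[OF this, of x] show ?thesis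
  proof (rule sums_cong[THEN iffD1, rotated])
    fix n
    define m where "m = real (Suc n)"
    have shift: "x + 1 + real n = m + x" and "m > 0" "m + x > 0" using assms by (auto simp: m_def)
    thus "(inverse (real (Suc n)) - inverse (x + 1 + real n)) / x
        = 1 / (real (Suc n) * (real (Suc n) + x))"
      using assms unfolding m_def[symmetric] shift
      by (simp add: divide_simps)
  qed
qed

lemma inverse_squares_sums: "(\<lambda>n. 1 / (real (Suc n))\<^sup>2) sums Polygamma 1 1"
  using Polygamma_LIMSEQ[of "1::real" 1] by (simp add: field_simps power2_eq_square)

section \<open>Growth of the harmonic numbers and Abel summation\<close>

lemma harm_square_over_n: "(\<lambda>n. (harm n)\<^sup>2 / real n) \<longlonglongrightarrow> 0"
proof -
  let ?c = "\<lambda>n. harm n - ln (real n)"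
  \<comment> \<open>Expand \<open>(c\<^sub>n + ln n)\<^sup>2\<close>, where \<open>c\<^sub>n = H\<^sub>n - ln n\<close> converges.\<close>
  have c: "?c \<longlonglongrightarrow> euler_mascheroni" by (rule euler_mascheroni_LIMSEQ)
  have "(\<lambda>n. (?c n)\<^sup>2 * (1 / real n) + 2 * ?c n * (ln (real n) / real n) + (ln (real n))\<^sup>2 / real n)
          \<longlonglongrightarrow> euler_mascheroni\<^sup>2 * 0 + 2 * euler_mascheroni * 0 + 0"
    by (intro tendsto_add tendsto_mult tendsto_power c tendsto_const; real_asymp)
  moreover have "(?c n)\<^sup>2 * (1 / real n) + 2 * ?c n * (ln (real n) / real n) + (ln (real n))\<^sup>2 / real n
      = (harm n)\<^sup>2 / real n" for n
    by (cases "n = 0") (simp_all add: field_simps power2_eq_square)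
  ultimately show ?thesis by simp
qed

lemma harm_over_n: "(\<lambda>n. harm n / real n) \<longlonglongrightarrow> 0"
proof (rule tendsto_sandwich[OF _ _ tendsto_const harm_square_over_n])
  show "\<forall>\<^sub>F n in sequentially. 0 \<le> harm n / real n"
    by (simp add: harm_nonneg)
  show "\<forall>\<^sub>F n in sequentially. harm n / real n \<le> (harm n)\<^sup>2 / real n"
    using eventually_gt_at_top[of 0]
  proof eventually_elim
    case (elim n)
    have "(1::real) \<le> harm n"
      using harm_mono[of 1 n, where ?'a = real] elim by (simp add: harm_expand)
    hence "harm n \<le> (harm n :: real)\<^sup>2" using self_le_power[of "harm n :: real" 2] by simp
    thus ?case by (intro divide_right_mono) auto
  qed
qed

text \<open>
  The boundary term \<open>u\<^sub>N / (N + x + 1)\<close> of summation by parts vanishes in the limit. With \<open>u\<close> the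
  harmonic numbers or their squares, this removes one factor \<open>H\<^sub>n\<close> from a series.
\<close>

lemma abel_summation_sums:
  fixes u :: "nat \<Rightarrow> real"
  assumes "u 0 = 0" and "x \<ge> 0" and lim: "(\<lambda>n. u n / real n) \<longlonglongrightarrow> 0"
    and sums: "(\<lambda>n. (u (Suc n) - u n) / (real (Suc n) + x)) sums s"
  shows "(\<lambda>n. u (Suc n) * (1 / (real (Suc n) + x) - 1 / (real (Suc n) + x + 1))) sums s"
proof -
  have partial: "(\<Sum>n<N. u (Suc n) * (1 / (real (Suc n) + x) - 1 / (real (Suc n) + x + 1)))
      = (\<Sum>n<N. (u (Suc n) - u n) / (real (Suc n) + x)) - u N / (real N + x + 1)" for N
    by (induction N) (simp_all add: assms(1) algebra_simps diff_divide_distrib)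
  have "(\<lambda>N. u N / (real N + x + 1)) \<longlonglongrightarrow> 0"
  proof (rule Lim_null_comparison[OF _ tendsto_rabs_zero[OF lim]])
    show "\<forall>\<^sub>F N in sequentially. norm (u N / (real N + x + 1)) \<le> \<bar>u N / real N\<bar>"
      using eventually_gt_at_top[of 0]
      by eventually_elim (use assms(2) in \<open>auto simp: abs_divide intro!: divide_left_mono\<close>)
  qed
  from tendsto_diff[OF sums[unfolded sums_def] this] show ?thesis
    unfolding sums_def partial by simp
qed

section \<open>The series linear in the harmonic numbers\<close>

text \<open>
  The difference \<open>f - g\<close> is 1-periodic and vanishes at the positive integers. If \<open>p\<close> is an
  integer with \<open>p \<le> x + n \<le> p + 1\<close>, monotonicity puts both \<open>f (x + n)\<close> and \<open>g (x + n)\<close> into the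
  interval from \<open>f p\<close> to \<open>f p + d p\<close>, whose length tends to zero as \<open>n\<close> grows.
\<close>

lemma difference_equation_mono_unique:
  fixes f g d :: "real \<Rightarrow> real"
  assumes mono: "mono_on {1..} f" "mono_on {1..} g"
    and f: "\<And>x. x > 0 \<Longrightarrow> f (x + 1) = f x + d x"
    and g: "\<And>x. x > 0 \<Longrightarrow> g (x + 1) = g x + d x"
    and lim: "(\<lambda>n. d (real n)) \<longlonglongrightarrow> 0"
    and one: "f 1 = g 1" and x: "x > 0"
  shows "f x = g x"
proof -
  have shift: "f (y + real n) - g (y + real n) = f y - g y" if "y > 0" for y n
  proof (induction n)
    case (Suc n)
    have "y + real (Suc n) = (y + real n) + 1" by simp
    with f[of "y + real n"] g[of "y + real n"] that
    have "f (y + real (Suc n)) - g (y + real (Suc n)) = f (y + real n) - g (y + real n)"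
      by (simp only:)
    with Suc show ?case by simp
  qed simp
  have nat: "f (real p) = g (real p)" if "p \<ge> 1" for p
    using shift[of 1 "p - 1"] one that by (simp add: of_nat_diff)
  define m where "m = nat \<lfloor>x\<rfloor>"
  have m: "real m \<le> x" "x \<le> real m + 1"
    using x unfolding m_def by linarith+
  have bound: "\<bar>f x - g x\<bar> \<le> d (real (n + m))" if "n \<ge> 1" for n
  proof -
    let ?p = "real (n + m)" and ?y = "x + real n"
    have p: "?p \<ge> 1" "?p \<le> ?y" "?y \<le> ?p + 1" using that m by auto
    have "f ?p \<le> f ?y" "f ?y \<le> f (?p + 1)" "g ?p \<le> g ?y" "g ?y \<le> g (?p + 1)"
      using p by (auto intro!: mono_onD[OF mono(1)] mono_onD[OF mono(2)])
    moreover have "f (?p + 1) = f ?p + d ?p" "g (?p + 1) = g ?p + d ?p"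
      using p(1) by (intro f g; linarith)+
    moreover have "f ?p = g ?p" using nat[of "n + m"] that by simp
    ultimately show ?thesis using shift[OF x, of n] by linarith
  qed
  have "(\<lambda>n. d (real (n + m))) \<longlonglongrightarrow> 0"
    by (rule LIMSEQ_ignore_initial_segment[OF lim])
  hence "\<bar>f x - g x\<bar> \<le> 0"
    by (rule tendsto_lowerbound) (use bound in \<open>auto intro!: eventually_sequentiallyI[of 1]\<close>)
  thus ?thesis by simp
qed

text \<open>
  Series and closed form solve the same difference equation, with increment \<open>real_harm y / y\<close>.
  Monotonicity is compared on \<open>[1, \<infinity>)\<close> because there \<open>real_harm (x - 1)\<close> is nonnegative, so that
  its square inherits monotonicity from it.
\<close>

lemma linear_harmonic_sums:
  assumes x: "x > 0"
  shows "(\<lambda>n. harm (Suc n) * (1 / real (Suc n) - 1 / (real (Suc n) + x))) sums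
           (Polygamma 1 1 + ((real_harm (x - 1))\<^sup>2 + real_harm2 (x - 1)) / 2)"
proof -
  let ?t = "\<lambda>x n. harm (Suc n) * (1 / real (Suc n) - 1 / (real (Suc n) + x))"
  let ?S = "\<lambda>x. \<Sum>n. ?t x n"
  let ?E = "\<lambda>x. Polygamma 1 1 + ((real_harm (x - 1))\<^sup>2 + real_harm2 (x - 1)) / 2"
  have one: "?t 1 sums Polygamma 1 1"
    using abel_summation_sums[of harm 0, OF _ _ harm_over_n] inverse_squares_sums
    by (simp add: harm_expand harm_Suc field_simps power2_eq_square)
  have nonneg: "?t y n \<ge> 0" if "y \<ge> 0" for y n
    using that by (intro mult_nonneg_nonneg harm_nonneg) (simp add: field_simps)
  have summable: "summable (?t y)" if y: "y > 0" for y
  proof (rule summable_comparison_test')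
    show "summable (\<lambda>n. (y + 1) * ?t 1 n)"
      using one by (intro summable_mult) (rule sums_summable)
    fix n :: nat
    \<comment> \<open>With \<open>m = n + 1\<close> this is \<open>y (m + 1) \<le> (y + 1) (m + y)\<close>, where the two sides differ by
      \<open>m + y\<^sup>2\<close>.\<close>
    have "1 / real (Suc n) - 1 / (real (Suc n) + y)
        \<le> (y + 1) * (1 / real (Suc n) - 1 / (real (Suc n) + 1))"
      using y by (simp add: divide_simps) (simp add: algebra_simps)
    hence "?t y n \<le> harm (Suc n) * ((y + 1) * (1 / real (Suc n) - 1 / (real (Suc n) + 1)))"
      by (intro mult_left_mono harm_nonneg)
    thus "norm (?t y n) \<le> (y + 1) * ?t 1 n"
      using nonneg[of y n] y by (simp add: mult_ac)
  qed
  have step: "?S (y + 1) = ?S y + real_harm y / y" if y: "y > 0" for y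
  proof -
    have "(\<lambda>n. harm (Suc n) * (1 / (real (Suc n) + y) - 1 / (real (Suc n) + y + 1)))
             sums (real_harm y / y)"
      using real_harm_sums[OF y] y
      by (intro abel_summation_sums harm_over_n)
         (simp_all add: harm_expand harm_Suc inverse_eq_divide)
    from sums_add[OF summable_sums[OF summable[OF y]] this]
    have "?t (y + 1) sums (?S y + real_harm y / y)"
      by (simp add: algebra_simps)
    thus ?thesis by (simp add: sums_iff)
  qed
  have "?S x = ?E x"
  proof (rule difference_equation_mono_unique[where f = ?S and g = ?E and d = "\<lambda>y. real_harm y / y"])
    show "mono_on {1..} ?S"
    proof (rule mono_onI)
      fix r s :: real
      assume rs: "r \<in> {1..}" "s \<in> {1..}" "r \<le> s"
      show "?S r \<le> ?S s"
        by (intro suminf_le summable mult_left_mono diff_left_mono divide_left_mono harm_nonneg)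
           (use rs in auto)
    qed
    show "mono_on {1..} ?E"
    proof (rule mono_onI)
      fix r s :: real
      assume rs: "r \<in> {1..}" "s \<in> {1..}" "r \<le> s"
      have "0 \<le> real_harm (r - 1)"
        using real_harm_mono[of 0 "r - 1"] rs by simp
      moreover have "real_harm (r - 1) \<le> real_harm (s - 1)" "real_harm2 (r - 1) \<le> real_harm2 (s - 1)"
        using rs by (auto intro!: real_harm_mono real_harm2_mono)
      ultimately have "(real_harm (r - 1))\<^sup>2 \<le> (real_harm (s - 1))\<^sup>2"
        "real_harm2 (r - 1) \<le> real_harm2 (s - 1)"
        by (auto intro!: power_mono)
      thus "?E r \<le> ?E s" by simp
    qed
    show "?S (y + 1) = ?S y + real_harm y / y" if "y > 0" for y
      by (rule step[OF that])
    show "?E (y + 1) = ?E y + real_harm y / y" if "y > 0" for y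
      using that by (simp add: real_harm_rec[of y] real_harm2_rec[of y])
                    (simp add: field_simps power2_eq_square)
    show "(\<lambda>n. real_harm (real n) / real n) \<longlonglongrightarrow> 0"
      by (simp add: real_harm_of_nat harm_over_n)
    show "?S 1 = ?E 1"
      using one by (simp add: sums_iff)
  qed (rule x)
  with summable_sums[OF summable[OF x]] show ?thesis by simp
qed

section \<open>The series quadratic in the harmonic numbers\<close>

text \<open>
  With \<open>m = n + 1\<close>, the increment of the squares is \<open>H\<^sub>m\<^sup>2 - H\<^sub>n\<^sup>2 = 2 H\<^sub>m / m - 1 / m\<^sup>2\<close>. Partial
  fractions of \<open>1 / (m (m + x))\<close> split the Abel-summed series into \<open>2 / x\<close> times the linear
  series and a part without harmonic numbers.
\<close>

lemma quadratic_harmonic_sums_step: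
  assumes x: "x > 0"
  shows "(\<lambda>n. (harm (Suc n))\<^sup>2 * (1 / (real (Suc n) + x) - 1 / (real (Suc n) + x + 1))) sums
           (Polygamma 1 1 / x - real_harm x / x\<^sup>2 + ((real_harm x)\<^sup>2 + real_harm2 x) / x)"
    (is "_ sums ?R")
proof (rule abel_summation_sums)
  let ?L = "Polygamma 1 1 + ((real_harm (x - 1))\<^sup>2 + real_harm2 (x - 1)) / 2"
  have "(\<lambda>n. 2 / x * (harm (Suc n) * (1 / real (Suc n) - 1 / (real (Suc n) + x)))
             - 1 / x * (1 / (real (Suc n))\<^sup>2 - 1 / (real (Suc n) * (real (Suc n) + x))))
          sums (2 / x * ?L - 1 / x * (Polygamma 1 1 - real_harm x / x))"
    by (intro sums_diff sums_mult linear_harmonic_sums inverse_squares_sums real_harm_sums x)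
  also have "2 / x * ?L - 1 / x * (Polygamma 1 1 - real_harm x / x) = ?R"
    using x by (simp add: real_harm_rec[of x] real_harm2_rec[of x])
               (simp add: field_simps power2_eq_square)
  finally show "(\<lambda>n. ((harm (Suc n))\<^sup>2 - (harm n)\<^sup>2) / (real (Suc n) + x)) sums ?R"
  proof (rule sums_cong[THEN iffD1, rotated])
    fix n
    define h where "h = (harm n :: real)"
    define m where "m = real (Suc n)"
    have "m > 0" "m + x > 0" using x by (auto simp: m_def)
    then show "2 / x * (harm (Suc n) * (1 / real (Suc n) - 1 / (real (Suc n) + x)))
             - 1 / x * (1 / (real (Suc n))\<^sup>2 - 1 / (real (Suc n) * (real (Suc n) + x)))
         = ((harm (Suc n))\<^sup>2 - (harm n)\<^sup>2) / (real (Suc n) + x)"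
      using x unfolding harm_Suc h_def[symmetric] m_def[symmetric]
      by (simp add: divide_simps) (simp add: algebra_simps power2_eq_square)
  qed
qed (use x harm_square_over_n in \<open>auto simp: harm_expand\<close>)

text \<open>
  Summing the case \<open>k = 1\<close> over \<open>x = a + j\<close> for \<open>j < k\<close> gives the series on the left. On the right,
  \<open>real_harm (a + j)\<close> in the terms with a squared denominator is written as \<open>real_harm a\<close> plus a
  finite sum, while in the last group it is kept as it is.
\<close>

lemma quadratic_harmonic_sums:
  assumes k: "k \<ge> 1" and a: "a > 0"
  shows "(\<lambda>n. (harm (Suc n))\<^sup>2 / ((real (Suc n) + a) * (real (Suc n) + a + real k))) sums
    (1 / real k *
      (Polygamma 1 1 * (\<Sum>j=1..k. 1 / (real j + (a - 1)))
       - real_harm a * (\<Sum>j=1..k. 1 / (real j + (a - 1))\<^sup>2)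
       - (\<Sum>i=1..k-1. (\<Sum>j=1..i. 1 / (real j + a)) / (real i + a)\<^sup>2)
       + (\<Sum>j=1..k. ((real_harm (a + real j - 1))\<^sup>2 + real_harm2 (a + real j - 1))
                     / (a + real j - 1))))"
    (is "?lhs sums (1 / real k * ?R)")
proof -
  have telescope: "(\<Sum>j<k. 1 / (real (Suc n) + (a + real j)) - 1 / (real (Suc n) + (a + real j) + 1))
      = real k / ((real (Suc n) + a) * (real (Suc n) + a + real k))" for n
  proof -
    have "(\<Sum>j<k. 1 / (real (Suc n) + (a + real j)) - 1 / (real (Suc n) + (a + real j) + 1))
        = (\<Sum>j<k. 1 / (real (Suc n) + a + real j) - 1 / (real (Suc n) + a + real (Suc j)))"
      by (intro sum.cong) (simp_all add: add_ac)
    also have "\<dots> = 1 / (real (Suc n) + a) - 1 / (real (Suc n) + a + real k)"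
      by (subst sum_lessThan_telescope') simp
    finally show ?thesis using a by (simp add: field_simps)
  qed
  have rh: "real_harm (a + real j) = real_harm a + (\<Sum>i=1..j. 1 / (real i + a))" for j
  proof (induction j)
    case (Suc j)
    show ?case using real_harm_rec[of "a + real (Suc j)"] a Suc by (simp add: add_ac)
  qed simp
  let ?F = "\<lambda>x. Polygamma 1 1 / x - real_harm x / x\<^sup>2 + ((real_harm x)\<^sup>2 + real_harm2 x) / x"
  have "(\<lambda>n. 1 / real k * (\<Sum>j<k. (harm (Suc n))\<^sup>2 *
            (1 / (real (Suc n) + (a + real j)) - 1 / (real (Suc n) + (a + real j) + 1))))
          sums (1 / real k * (\<Sum>j<k. ?F (a + real j)))"
    using a by (intro sums_mult sums_sum quadratic_harmonic_sums_step) auto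
  also have "(\<lambda>n. 1 / real k * (\<Sum>j<k. (harm (Suc n))\<^sup>2 *
            (1 / (real (Suc n) + (a + real j)) - 1 / (real (Suc n) + (a + real j) + 1)))) = ?lhs"
    unfolding sum_distrib_left[symmetric] telescope using k by (auto simp: fun_eq_iff)
  also have "(\<Sum>j<k. ?F (a + real j)) = ?R"
  proof -
    have shift: "(\<Sum>j=1..k. f j) = (\<Sum>j<k. f (Suc j))" for f :: "nat \<Rightarrow> real"
      by (rule sum.reindex_bij_witness[of _ Suc "\<lambda>j. j - 1"]) auto
    \<comment> \<open>The additional term \<open>i = 0\<close> has an empty inner sum.\<close>
    have inner: "(\<Sum>i=1..k-1. (\<Sum>j=1..i. 1 / (real j + a)) / (real i + a)\<^sup>2)
        = (\<Sum>i<k. (\<Sum>j=1..i. 1 / (real j + a)) / (real i + a)\<^sup>2)"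
      by (rule sum.mono_neutral_left) (auto simp: not_le)
    have "?R = (\<Sum>j<k. Polygamma 1 1 * (1 / (a + real j)) - real_harm a * (1 / (a + real j)\<^sup>2)
             - (\<Sum>i=1..j. 1 / (real i + a)) / (a + real j)\<^sup>2
             + ((real_harm (a + real j))\<^sup>2 + real_harm2 (a + real j)) / (a + real j))"
      unfolding inner unfolding shift
      by (simp add: sum.distrib sum_subtractf sum_distrib_left add_ac)
    also have "\<dots> = (\<Sum>j<k. ?F (a + real j))"
      by (intro sum.cong refl, subst rh, subst rh) (simp add: rh add_divide_distrib)
    finally show ?thesis ..
  qed
  finally show ?thesis .
qed

section \<open>Transfer to the complex numbers\<close>

lemma powr_minus_2_of_real: "(z::complex) \<noteq> 0 \<Longrightarrow> z powr (-2) = 1 / z\<^sup>2"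
  by (simp add: powr_minus inverse_eq_divide powr_numeral)

lemma riemann_zeta_2: "riemann_zeta 2 = of_real (Polygamma 1 1)"
proof -
  have "riemann_zeta 2 = (\<Sum>n. of_real (1 / (real (Suc n))\<^sup>2))"
    unfolding riemann_zeta_def
    by (rule arg_cong[where f = suminf]) (simp add: fun_eq_iff powr_minus_2_of_real del: of_nat_Suc)
  thus ?thesis
    using sums_of_real[OF inverse_squares_sums, where ?'a = complex] by (simp add: sums_iff)
qed

lemma hurwitz_zeta_2: "x > 0 \<Longrightarrow> hurwitz_zeta 2 (of_real x) = of_real (Polygamma 1 x)"
proof -
  assume x: "x > 0"
  have nz: "of_nat n + complex_of_real x \<noteq> 0" for n
  proof -
    have "of_nat n + complex_of_real x = of_real (real n + x)" by simp
    thus ?thesis using x by (metis add_nonneg_pos of_nat_0_le_iff of_real_eq_0_iff less_irrefl)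
  qed
  have "(\<lambda>n. inverse ((x + real n) ^ Suc 1)) sums Polygamma 1 x"
    using Polygamma_LIMSEQ[of x 1] x by simp
  from sums_of_real[OF this, where ?'a = complex]
  have "(\<lambda>n. (of_nat n + complex_of_real x) powr (-2)) sums of_real (Polygamma 1 x)"
    by (simp add: powr_minus_2_of_real[OF nz] power2_eq_square inverse_eq_divide add_ac)
  thus ?thesis unfolding hurwitz_zeta_def by (simp add: sums_iff)
qed

lemma shifted_harm_of_real: "x > -1 \<Longrightarrow> shifted_harm (of_real x) = of_real (real_harm x)"
  using Polygamma_of_real[of "x + 1" 0, where ?'a = complex]
  by (simp add: shifted_harm_def real_harm_def)

lemma shifted_harm2_of_real: "x > -1 \<Longrightarrow> shifted_harm2 (of_real x) = of_real (real_harm2 x)"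
  using hurwitz_zeta_2[of "x + 1"]
  by (simp add: shifted_harm2_def real_harm2_def riemann_zeta_2)

lemma param_harm_of_real:
  assumes "c > -1"
  shows "param_harm n 1 (of_real c) = of_real (\<Sum>j=1..n. 1 / (real j + c))"
    and "param_harm n 2 (of_real c) = of_real (\<Sum>j=1..n. 1 / (real j + c)\<^sup>2)"
proof -
  have nz: "of_nat j + complex_of_real c \<noteq> 0" if "j \<ge> 1" for j
  proof -
    have "real j + c \<noteq> 0" using that assms by linarith
    hence "complex_of_real (real j + c) \<noteq> 0" by (simp only: of_real_eq_0_iff not_False_eq_True)
    thus ?thesis by simp
  qed
  show "param_harm n 1 (of_real c) = of_real (\<Sum>j=1..n. 1 / (real j + c))"
    unfolding param_harm_def of_real_sum
    by (intro sum.cong) (auto simp: powr_minus nz inverse_eq_divide)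
  show "param_harm n 2 (of_real c) = of_real (\<Sum>j=1..n. 1 / (real j + c)\<^sup>2)"
    unfolding param_harm_def of_real_sum
    by (intro sum.cong) (auto simp: powr_minus_2_of_real nz)
qed

theorem theorem3p4:
  fixes k :: nat and a :: real
  assumes "k \<ge> 1" and "a > 0"
  shows "(\<lambda>n. (harm (Suc n))\<^sup>2 /
             ((of_nat (Suc n) + of_real a) * (of_nat (Suc n) + of_real a + of_nat k)))
         sums
         (1 / of_nat k *
           (riemann_zeta 2 * param_harm k 1 (of_real a - 1)
            - shifted_harm (of_real a) * param_harm k 2 (of_real a - 1)
            - (\<Sum>i=1..k-1. param_harm i 1 (of_real a) / (of_nat i + of_real a)\<^sup>2)
            + (\<Sum>j=1..k. ((shifted_harm (of_real a + of_nat j - 1))\<^sup>2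
                          + shifted_harm2 (of_real a + of_nat j - 1))
                         / (of_real a + of_nat j - 1))))"
proof -
  have sh: "shifted_harm (of_real a + of_nat j - 1) = of_real (real_harm (a + real j - 1))"
    "shifted_harm2 (of_real a + of_nat j - 1) = of_real (real_harm2 (a + real j - 1))" for j
    using shifted_harm_of_real[of "a + real j - 1"] shifted_harm2_of_real[of "a + real j - 1"] assms(2)
    by simp_all
  have ph: "param_harm k 1 (of_real a - 1) = of_real (\<Sum>j=1..k. 1 / (real j + (a - 1)))"
    "param_harm k 2 (of_real a - 1) = of_real (\<Sum>j=1..k. 1 / (real j + (a - 1))\<^sup>2)"
    using param_harm_of_real[of "a - 1" k] assms(2) by simp_all
  have ph': "param_harm i 1 (of_real a) = of_real (\<Sum>j=1..i. 1 / (real j + a))" for i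
    using param_harm_of_real(1)[of a i] assms(2) by simp
  have sa: "shifted_harm (of_real a) = of_real (real_harm a)"
    using shifted_harm_of_real[of a] assms(2) by simp
  from sums_of_real[OF quadratic_harmonic_sums[OF assms], where ?'a = complex] show ?thesis
    unfolding sh ph ph' sa riemann_zeta_2
    by (simp add: of_real_harm)
qed

end
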